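(* Let $K\subset\mathbb R^n$ be a generating set, let $C\subset\mathbb R^n$ be a convex compactum, and let $X_0, X_1, \ldots, X_n\subset \mathbb R^n$ be finite sets. Suppose that every system of representatives $x_0\in X_0$, $x_1\in X_1$, $\ldots$, $x_n\in X_n$ can be separated from $C$ by a translate $K-t$ ($t\in\mathbb R^n$). Then there exist an index $0\le i\le n$ and a translate of $K$ that separates $X_i$ from $C$.
   Context: A convex body is a compact convex subset of $\mathbb R^n$ with nonempty interior; a convex compactum is a compact convex set. For a convex body $K$ and a set $T\subset\mathbb R^n$ write $K\dot{-}T=\bigcap_{t\in T}(K-t)$. A convex body $K$ is a generating set if for every $T\subset\mathbb R^n$ with $K\dot{-}T\neq\emptyset$, the set $K\dot{-}T$ is a Minkowski summand of $K$, i.e. $(K\dot{-}T)+T'=K$ for some convex compactum $T'$. A translate $K-t$ separates a set $S$ from a convex compactum $C$ if $S\subseteq K-t$ and $(K-t)\cap C=\emptyset$. *)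

theory Defs
  imports "HOL-Analysis.Analysis"
begin

definition convex_compactum :: "'a::euclidean_space set \<Rightarrow> bool"
  where "convex_compactum C \<longleftrightarrow> compact C \<and> convex C"

definition convex_body :: "'a::euclidean_space set \<Rightarrow> bool"
  where "convex_body K \<longleftrightarrow> compact K \<and> convex K \<and> interior K \<noteq> {}"

definition translate_by :: "'a::euclidean_space set \<Rightarrow> 'a \<Rightarrow> 'a set"
  where "translate_by K t = (\<lambda>x. x - t) ` K"

definition minkowski_diff :: "'a::euclidean_space set \<Rightarrow> 'a set \<Rightarrow> 'a set"
  where "minkowski_diff K T = (\<Inter>t\<in>T. translate_by K t)"

text \<open>The sum below is the Minkowski sum from \<^theory>\<open>HOL-Library.Set_Algebras\<close>.\<close>

definition minkowski_summand :: "'a::euclidean_space set \<Rightarrow> 'a set \<Rightarrow> bool"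
  where "minkowski_summand A K \<longleftrightarrow> (\<exists>T'. convex_compactum T' \<and> A + T' = K)"

text \<open>
  The index set \<open>T\<close> has to be nonempty: \<open>minkowski_diff K {}\<close> is an empty
  intersection, hence the whole space, which is not a summand of a bounded
  nonempty set in positive dimension. Without this restriction no generating
  set would exist there.
\<close>

definition generating_set :: "'a::euclidean_space set \<Rightarrow> bool"
  where "generating_set K \<longleftrightarrow> convex_body K \<and>
    (\<forall>T. T \<noteq> {} \<longrightarrow> minkowski_diff K T \<noteq> {} \<longrightarrow> minkowski_summand (minkowski_diff K T) K)"

definition separates :: "'a::euclidean_space set \<Rightarrow> 'a set \<Rightarrow> 'a set \<Rightarrow> bool"
  where "separates L S C \<longleftrightarrow> S \<subseteq> L \<and> L \<inter> C = {}"

end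

theory Submission
  imports Defs
begin

text \<open>
  Write \<open>A S\<close> for \<open>minkowski_diff K S\<close> and \<open>L = K - C\<close>. A translate \<open>K - t\<close> separates \<open>S\<close> from \<open>C\<close>
  iff \<open>t \<in> A S - L\<close>, so suppose that \<open>A (X i) \<subseteq> L\<close> for all \<open>i\<close> while no rainbow set \<open>S\<close> has
  \<open>A S \<subseteq> L\<close>; by compactness \<open>C\<close> can be enlarged slightly so that even \<open>A (X i) \<subseteq> interior L\<close>.

  On a sufficiently fine Freudenthal--Kuhn triangulation of a large ball, colour the vertices by
  their coordinate sum modulo \<open>n + 1\<close>, so that the vertices of each simplex have distinct colours.
  Every vertex \<open>z\<close> of colour \<open>i\<close> gets a point \<open>\<xi> z \<in> X i\<close> such that \<open>K - \<xi> z\<close> misses the star of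
  \<open>z\<close> outside \<open>interior L\<close>. Let \<open>T t\<close> be the set of vertices whose bump function is maximal at \<open>t\<close>;
  its labels form part of a rainbow set. Hence the directions \<open>p\<close> that separate some point of
  \<open>A (\<xi> ` T t)\<close> from \<open>L\<close> form a nonempty set, which is convex because \<open>K\<close> is generating. Select
  continuously first such a direction \<open>p t\<close>, and then a point \<open>g t \<in> A (\<xi> ` T t)\<close> beyond \<open>L\<close> in
  direction \<open>p t\<close>. A Brouwer fixed point \<open>t\<close> of \<open>g\<close> lies in \<open>K - \<xi> z\<close> and in the star of \<open>z\<close> for
  any \<open>z \<in> T t\<close>, hence in \<open>L\<close>, whereas \<open>g t \<notin> L\<close>.
\<close>

section \<open>Continuous selections\<close>

text \<open>A partition of unity: each chosen \<open>s t\<close> stays admissible on a ball around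
  \<open>t\<close>, finitely many such balls cover \<open>S\<close>, and at \<open>x\<close> only
  points already in \<open>\<Phi> x\<close> get positive weight, so convexity finishes.\<close>

lemma continuous_selection_open_lower_sections:
  fixes S :: "'a::metric_space set" and \<Phi> :: "'a \<Rightarrow> 'b::real_normed_vector set"
  assumes "compact S"
    and cvx: "\<And>t. t \<in> S \<Longrightarrow> convex (\<Phi> t)"
    and ne: "\<And>t. t \<in> S \<Longrightarrow> \<Phi> t \<noteq> {}"
    and low: "\<And>t s. t \<in> S \<Longrightarrow> s \<in> \<Phi> t \<Longrightarrow> \<forall>\<^sub>F t' in at t within S. s \<in> \<Phi> t'"
  obtains g where "continuous_on S g" "\<And>t. t \<in> S \<Longrightarrow> g t \<in> \<Phi> t"
proof -
  have "\<exists>s r. r > 0 \<and> (\<forall>t'\<in>S. dist t t' < r \<longrightarrow> s \<in> \<Phi> t')" if t: "t \<in> S" for t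
  proof -
    obtain s where s: "s \<in> \<Phi> t" using ne[OF t] by auto
    from low[OF t s] obtain r where "r > 0" "\<And>t'. t' \<in> S \<Longrightarrow> t' \<noteq> t \<Longrightarrow> dist t' t < r \<Longrightarrow> s \<in> \<Phi> t'"
      unfolding eventually_at by auto
    then show ?thesis using s by (metis dist_commute)
  qed
  then obtain s r where r: "\<And>t. t \<in> S \<Longrightarrow> r t > 0"
    and s: "\<And>t t'. \<lbrakk>t \<in> S; t' \<in> S; dist t t' < r t\<rbrakk> \<Longrightarrow> s t \<in> \<Phi> t'"
    by metis
  have "S \<subseteq> (\<Union>t\<in>S. ball t (r t))" using r by force
  then obtain T where T: "T \<subseteq> S" "finite T" "S \<subseteq> (\<Union>t\<in>T. ball t (r t))"
    using compactE_image[OF \<open>compact S\<close>, of S "\<lambda>t. ball t (r t)"] by blast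
  define w where "w t x = max 0 (r t - dist t x)" for t x
  define W where "W x = (\<Sum>t\<in>T. w t x)" for x
  have w0: "w t x \<ge> 0" for t x by (simp add: w_def)
  have Wpos: "W x > 0" if x: "x \<in> S" for x
  proof -
    obtain t where t: "t \<in> T" "dist t x < r t" using T x by auto
    have "w t x > 0" using t by (simp add: w_def)
    then show ?thesis unfolding W_def using t T w0 by (meson sum_pos2)
  qed
  define g where "g x = (\<Sum>t\<in>T. (w t x / W x) *\<^sub>R s t)" for x
  have "continuous_on S g"
    unfolding g_def
  proof (intro continuous_intros)
    show "continuous_on S (w t)" for t unfolding w_def by (intro continuous_intros)
    then show "continuous_on S W" unfolding W_def by (intro continuous_intros)
    show "\<forall>x\<in>S. W x \<noteq> 0" using Wpos by force
  qed
  moreover have "g x \<in> \<Phi> x" if x: "x \<in> S" for x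
  proof -
    define T' where "T' = {t \<in> T. w t x > 0}"
    have z: "w t x = 0" if "t \<in> T - T'" for t using that w0[of t x] by (auto simp: T'_def)
    have g': "g x = (\<Sum>t\<in>T'. (w t x / W x) *\<^sub>R s t)"
      unfolding g_def by (rule sum.mono_neutral_right) (use T z in \<open>auto simp: T'_def\<close>)
    have W': "W x = (\<Sum>t\<in>T'. w t x)"
      unfolding W_def by (rule sum.mono_neutral_right) (use T z in \<open>auto simp: T'_def\<close>)
    show ?thesis unfolding g'
    proof (rule convex_sum)
      show "finite T'" using T by (simp add: T'_def)
      show "(\<Sum>t\<in>T'. w t x / W x) = 1"
        using Wpos[OF x] by (simp add: sum_divide_distrib[symmetric] W'[symmetric])
      show "s t \<in> \<Phi> x" if "t \<in> T'" for t
        using that T x by (intro s) (auto simp: T'_def w_def)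
      show "w t x / W x \<ge> 0" for t using w0[of t x] Wpos[OF x] by simp
    qed (use cvx x in auto)
  qed
  ultimately show ?thesis using that by blast
qed

section \<open>Minkowski differences and separating translates\<close>

lemma mem_minkowski_diff: "s \<in> minkowski_diff K T \<longleftrightarrow> (\<forall>x\<in>T. s + x \<in> K)"
proof -
  have "s \<in> translate_by K x \<longleftrightarrow> s + x \<in> K" for x
    by (force simp: translate_by_def algebra_simps)
  then show ?thesis by (simp add: minkowski_diff_def)
qed

lemma minkowski_diff_antimono: "S \<subseteq> T \<Longrightarrow> minkowski_diff K T \<subseteq> minkowski_diff K S"
  unfolding minkowski_diff_def by (rule INT_anti_mono) auto

lemma mem_differences: "(a :: 'a::ab_group_add) \<in> {k - c |k c. k \<in> K \<and> c \<in> C} \<longleftrightarrow> (\<exists>c\<in>C. a + c \<in> K)"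
  by (force simp: algebra_simps)

lemma separates_translate_iff:
  "separates (translate_by K t) S C \<longleftrightarrow>
     t \<in> minkowski_diff K S - {k - c |k c. k \<in> K \<and> c \<in> C}"
proof -
  have "s \<in> translate_by K t \<longleftrightarrow> t + s \<in> K" for s
    by (force simp: translate_by_def algebra_simps)
  then show ?thesis by (auto simp: separates_def mem_minkowski_diff mem_differences simp del: mem_Collect_eq)
qed

lemma compact_minkowski_diff:
  assumes "compact K" "S \<noteq> {}"
  shows "compact (minkowski_diff K S)"
proof -
  have c: "compact (translate_by K t)" for t
    unfolding translate_by_def using assms by (simp add: compact_translation_subtract)
  obtain x where x: "x \<in> S" using assms by auto
  have "minkowski_diff K S = translate_by K x \<inter> (\<Inter>t\<in>S. translate_by K t)"
    using x by (auto simp: minkowski_diff_def)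
  moreover have "closed (\<Inter>t\<in>S. translate_by K t)"
    using c by (intro closed_INT ballI compact_imp_closed)
  ultimately show ?thesis using c by (simp add: compact_Int_closed)
qed

lemma convex_minkowski_diff: "convex K \<Longrightarrow> convex (minkowski_diff K S)"
  unfolding minkowski_diff_def translate_by_def
  by (auto intro!: convex_INT simp: convex_translation_subtract)

section \<open>Separating directions\<close>

text \<open>For compact nonempty \<open>A\<close> and \<open>L\<close>, these are the directions in
  which the support function of \<open>A\<close> exceeds that of \<open>L\<close>.\<close>

definition separating_directions :: "'a::euclidean_space set \<Rightarrow> 'a set \<Rightarrow> 'a set"
  where "separating_directions A L = {p. \<exists>t\<in>A. \<forall>l\<in>L. p \<bullet> l < p \<bullet> t}"

lemma separating_directions_mono: "A \<subseteq> B \<Longrightarrow> separating_directions A L \<subseteq> separating_directions B L"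
  by (auto simp: separating_directions_def)

lemma separating_directions_nonempty:
  assumes "closed L" "convex L" "\<not> A \<subseteq> L"
  shows "separating_directions A L \<noteq> {}"
proof -
  obtain t where t: "t \<in> A" "t \<notin> L" using assms by auto
  obtain a b where "a \<bullet> t < b" "\<forall>x\<in>L. a \<bullet> x > b"
    using separating_hyperplane_closed_point[OF assms(2,1) t(2)] by auto
  then have "-a \<in> separating_directions A L"
    using t by (force simp: separating_directions_def)
  then show ?thesis by auto
qed

text \<open>
  Here the generating property enters: if \<open>A + B = K\<close>, then \<open>p\<close> separates \<open>A\<close> from
  \<open>K - C = A + (B - C)\<close> exactly when \<open>p\<close> is negative on \<open>B - C\<close>, a convex condition on \<open>p\<close>.
\<close>

lemma convex_separating_directions_summand:
  assumes A: "compact A" and K: "A + B = K"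
  shows "convex (separating_directions A {k - c |k c. k \<in> K \<and> c \<in> C})"
    (is "convex (separating_directions A ?L)")
proof (cases "A = {}")
  case False
  have neg: "p \<bullet> b < p \<bullet> c" if p: "p \<in> separating_directions A ?L" and bc: "b \<in> B" "c \<in> C" for p b c
  proof -
    obtain t where t: "t \<in> A" "\<forall>l\<in>?L. p \<bullet> l < p \<bullet> t"
      using p unfolding separating_directions_def by blast
    have "t + b \<in> K" using t bc K by (auto simp: set_plus_def)
    then have "(t + b) - c \<in> ?L" using bc by blast
    then have "p \<bullet> ((t + b) - c) < p \<bullet> t" using t by blast
    then show ?thesis by (simp add: inner_simps)
  qed
  have pos: "r \<in> separating_directions A ?L" if r: "\<And>b c. b \<in> B \<Longrightarrow> c \<in> C \<Longrightarrow> r \<bullet> b < r \<bullet> c" for r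
  proof -
    \<comment> \<open>A maximiser \<open>t\<close> of \<open>r\<close> on \<open>A\<close> serves
      all of \<open>L\<close> at once: for l = a + b - c the value at l is strictly below that at a,
      hence below that at \<open>t\<close>.\<close>
    have "continuous_on A (\<lambda>x. r \<bullet> x)" by (intro continuous_intros)
    from continuous_attains_sup[OF A False this]
    obtain t where t: "t \<in> A" "\<forall>a\<in>A. r \<bullet> a \<le> r \<bullet> t" by auto
    have "r \<bullet> l < r \<bullet> t" if l: "l \<in> ?L" for l
    proof -
      obtain a b c where "a \<in> A" "b \<in> B" "c \<in> C" "l = a + b - c"
        using l K by (auto simp: set_plus_def)
      then show ?thesis using t r[of b c] by (force simp: inner_simps)
    qed
    then show ?thesis using t by (auto simp: separating_directions_def)
  qed
  show ?thesis
  proof (rule convexI)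
    fix p q and u v :: real
    assume p: "p \<in> separating_directions A ?L" and q: "q \<in> separating_directions A ?L"
      and uv: "0 \<le> u" "0 \<le> v" "u + v = 1"
    show "u *\<^sub>R p + v *\<^sub>R q \<in> separating_directions A ?L"
    proof (rule pos)
      fix b c assume bc: "b \<in> B" "c \<in> C"
      have "u * (p \<bullet> b - p \<bullet> c) + v * (q \<bullet> b - q \<bullet> c) < 0"
        using neg[OF p bc] neg[OF q bc] uv
        by (intro convex_bound_lt) auto
      then show "(u *\<^sub>R p + v *\<^sub>R q) \<bullet> b < (u *\<^sub>R p + v *\<^sub>R q) \<bullet> c"
        by (simp add: inner_simps algebra_simps)
    qed
  qed
qed (simp add: separating_directions_def)

lemma convex_separating_directions:
  assumes "generating_set K" "S \<noteq> {}"
  shows "convex (separating_directions (minkowski_diff K S) {k - c |k c. k \<in> K \<and> c \<in> C})"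
proof (cases "minkowski_diff K S = {}")
  case True
  then show ?thesis by (simp add: separating_directions_def)
next
  case False
  then obtain B where "minkowski_diff K S + B = K"
    using assms by (auto simp: generating_set_def minkowski_summand_def)
  moreover have "compact (minkowski_diff K S)"
    using assms by (intro compact_minkowski_diff) (auto simp: generating_set_def convex_body_def)
  ultimately show ?thesis by (rule convex_separating_directions_summand[rotated])
qed

text \<open>Compactness of \<open>L\<close> gives a uniform gap \<open>d\<close> and a bound
  \<open>R\<close> on \<open>norm (s - l)\<close>; turning the direction by less than
  \<open>d / R\<close> cannot close the gap.\<close>

lemma eventually_separating:
  assumes "compact L" "continuous_on S p" "t \<in> S" "\<forall>l\<in>L. p t \<bullet> l < p t \<bullet> s"
  shows "\<forall>\<^sub>F t' in at t within S. \<forall>l\<in>L. p t' \<bullet> l < p t' \<bullet> s"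
proof (cases "L = {}")
  case False
  have "continuous_on L (\<lambda>l. p t \<bullet> (s - l))" by (intro continuous_intros)
  from continuous_attains_inf[OF assms(1) False this]
  obtain m where m: "m \<in> L" "\<forall>l\<in>L. p t \<bullet> (s - m) \<le> p t \<bullet> (s - l)" by auto
  define d where "d = p t \<bullet> (s - m)"
  have d: "d > 0" using assms(4) m by (auto simp: d_def inner_simps)
  have "bounded ((\<lambda>l. s - l) ` L)"
    using assms(1) by (intro compact_imp_bounded compact_continuous_image continuous_intros)
  then obtain R where R: "R > 0" "\<forall>l\<in>L. norm (s - l) \<le> R" by (auto simp: bounded_pos)
  have "(p \<longlongrightarrow> p t) (at t within S)" using assms by (auto simp: continuous_on_def)
  then have "\<forall>\<^sub>F t' in at t within S. dist (p t') (p t) < d / R"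
    using d R by (intro tendstoD) auto
  then show ?thesis
  proof eventually_elim
    case (elim t')
    show ?case
    proof
      fix l assume l: "l \<in> L"
      have "\<bar>(p t' - p t) \<bullet> (s - l)\<bar> \<le> norm (p t' - p t) * norm (s - l)"
        by (rule Cauchy_Schwarz_ineq2)
      also have "\<dots> \<le> norm (p t' - p t) * R" using R l by (intro mult_left_mono) auto
      also have "\<dots> < d" using elim R by (simp add: dist_norm field_simps)
      finally have "(p t' - p t) \<bullet> (s - l) > -d" by linarith
      moreover have "p t \<bullet> (s - l) \<ge> d" using m l by (simp add: d_def)
      ultimately show "p t' \<bullet> l < p t' \<bullet> s" by (simp add: inner_simps)
    qed
  qed
qed simp

section \<open>A coloured fine cover from the Freudenthal-Kuhn triangulation\<close>

text \<open>
  The support is the open star of the vertex \<open>h z\<close> in the Freudenthal--Kuhn triangulation of the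
  scaled integer lattice. Writing
  \<open>u = t / h - z\<close> and \<open>u None = 0\<close>, that star is given by \<open>u a - u b < 1\<close> for all \<open>a, b\<close>.
\<close>

definition lattice_bump :: "real \<Rightarrow> int ^ 'n \<Rightarrow> real ^ 'n \<Rightarrow> real"
  where "lattice_bump h z t =
    (let u = (\<lambda>a. case a of None \<Rightarrow> 0 | Some k \<Rightarrow> t $ k / h - of_int (z $ k))
     in \<Prod>a\<in>UNIV. \<Prod>b\<in>UNIV. max 0 (1 - (u a - u b)))"

lemma lattice_bump_nonneg: "lattice_bump h z t \<ge> 0"
  unfolding lattice_bump_def Let_def by (intro prod_nonneg) auto

lemma lattice_bump_pos_iff:
  "lattice_bump h z t > 0 \<longleftrightarrow>
    (\<forall>k. \<bar>t $ k / h - of_int (z $ k)\<bar> < 1) \<and>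
    (\<forall>k l. (t $ k / h - of_int (z $ k)) - (t $ l / h - of_int (z $ l)) < 1)"
    (is "_ \<longleftrightarrow> ?R")
proof -
  define u where "u = (\<lambda>a. case a of None \<Rightarrow> 0 | Some k \<Rightarrow> t $ k / h - of_int (z $ k))"
  have "lattice_bump h z t > 0 \<longleftrightarrow> lattice_bump h z t \<noteq> 0"
    using lattice_bump_nonneg[of h z t] by linarith
  also have "\<dots> \<longleftrightarrow> (\<forall>a b. max 0 (1 - (u a - u b)) \<noteq> 0)"
    by (auto simp: lattice_bump_def u_def[symmetric] Let_def)
  also have "\<dots> \<longleftrightarrow> (\<forall>a b. u a - u b < 1)"
    by (simp add: max_def) (smt (verit))
  \<comment> \<open>Pairs containing \<open>None\<close> give the two-sided bounds; pairs of
    \<open>Some\<close> give the mutual differences.\<close>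
  also have "\<dots> \<longleftrightarrow> ?R"
    by (auto simp: split_option_all u_def abs_less_iff)
  finally show ?thesis .
qed

lemma continuous_lattice_bump: "continuous_on S (lattice_bump h z)"
proof -
  have "continuous_on S (\<lambda>t. case a of None \<Rightarrow> 0 | Some k \<Rightarrow> t $ k / h - of_int (z $ k))" for a
    by (cases a) (auto simp: divide_inverse intro!: continuous_intros)
  then show ?thesis
    unfolding lattice_bump_def Let_def by (intro continuous_intros)
qed

text \<open>The stars cover the space: fractional parts lie in [0,1), so any two differ by less than
  1.\<close>

lemma lattice_bump_floor_pos:
  "lattice_bump h (\<chi> k. \<lfloor>t $ k / h\<rfloor>) t > 0"
proof -
  have *: "0 \<le> x - real_of_int \<lfloor>x\<rfloor> \<and> x - real_of_int \<lfloor>x\<rfloor> < 1" for x by linarith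
  have "(t $ k / h - of_int \<lfloor>t $ k / h\<rfloor>) - (t $ l / h - of_int \<lfloor>t $ l / h\<rfloor>) < 1" for k l
    using *[of "t $ k / h"] *[of "t $ l / h"] by linarith
  then show ?thesis using * by (simp add: lattice_bump_pos_iff)
qed

lemma lattice_bump_dist:
  fixes t t' :: "real ^ 'n"
  assumes "h > 0" "lattice_bump h z t > 0" "lattice_bump h z t' > 0"
  shows "dist t t' \<le> 2 * real CARD('n) * h"
proof -
  have "\<bar>t $ k - t' $ k\<bar> \<le> 2 * h" for k
  proof -
    have "\<bar>t $ k / h - of_int (z $ k)\<bar> < 1" "\<bar>t' $ k / h - of_int (z $ k)\<bar> < 1"
      using assms by (auto simp: lattice_bump_pos_iff)
    then have "\<bar>t $ k / h - t' $ k / h\<bar> < 2" by linarith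
    then have "\<bar>(t $ k - t' $ k) / h\<bar> < 2" by (simp add: diff_divide_distrib)
    then show ?thesis using assms(1) by (simp add: abs_divide field_simps)
  qed
  then have "(\<Sum>k\<in>UNIV. \<bar>(t - t') $ k\<bar>) \<le> of_nat CARD('n) * (2 * h)"
    by (intro sum_bounded_above) auto
  then show ?thesis using norm_le_l1_cart[of "t - t'"] by (simp add: dist_norm mult_ac)
qed

definition lattice_color :: "int ^ 'n \<Rightarrow> nat"
  where "lattice_color z = nat ((\<Sum>k\<in>UNIV. z $ k) mod (int CARD('n) + 1))"

lemma lattice_color_le: "lattice_color (z :: int ^ 'n) \<le> CARD('n)"
proof -
  have "(\<Sum>k\<in>UNIV. z $ k) mod (int CARD('n) + 1) < int CARD('n) + 1"
    by (intro pos_mod_bound) simp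
  then show ?thesis unfolding lattice_color_def by linarith
qed

text \<open>By integrality the entries of \<open>w - v\<close> are -1, 0 or 1, and
  \<open>spread\<close> forbids opposite signs. Their sum is at most n in absolute value and
  divisible by n + 1, hence 0; with equal signs every entry vanishes.\<close>

lemma lattice_color_inj:
  fixes v w :: "int ^ 'n"
  assumes v: "lattice_bump h v t > 0" and w: "lattice_bump h w t > 0"
    and col: "lattice_color v = lattice_color w"
  shows "v = w"
proof -
  define d where "d k = w $ k - v $ k" for k
  have bnd: "\<bar>d k\<bar> \<le> 1" for k
  proof -
    have "\<bar>t $ k / h - of_int (v $ k)\<bar> < 1" "\<bar>t $ k / h - of_int (w $ k)\<bar> < 1"
      using v w by (auto simp: lattice_bump_pos_iff)
    then have "\<bar>real_of_int (d k)\<bar> < 2" by (simp add: d_def)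
    then show ?thesis by linarith
  qed
  have spread: "d k - d l \<le> 1" for k l
  proof -
    have "(t $ k / h - of_int (v $ k)) - (t $ l / h - of_int (v $ l)) < 1"
         "(t $ l / h - of_int (w $ l)) - (t $ k / h - of_int (w $ k)) < 1"
      using v w by (auto simp: lattice_bump_pos_iff)
    then have "real_of_int (d k - d l) < 2" by (simp add: d_def)
    then show ?thesis by linarith
  qed
  have "(\<Sum>k\<in>UNIV. w $ k) mod (int CARD('n) + 1) = (\<Sum>k\<in>UNIV. v $ k) mod (int CARD('n) + 1)"
    using col unfolding lattice_color_def by (subst (asm) eq_nat_nat_iff) auto
  then have "int CARD('n) + 1 dvd (\<Sum>k\<in>UNIV. w $ k) - (\<Sum>k\<in>UNIV. v $ k)"
    by (simp add: mod_eq_dvd_iff)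
  then have dvd: "int CARD('n) + 1 dvd (\<Sum>k\<in>UNIV. d k)"
    by (simp add: d_def sum_subtractf)
  have small: "\<bar>\<Sum>k\<in>UNIV. d k\<bar> \<le> int CARD('n)"
    using sum_bounded_above[of UNIV "\<lambda>k. \<bar>d k\<bar>" 1] bnd
    by (intro order_trans[OF sum_abs]) auto
  have sum0: "(\<Sum>k\<in>UNIV. d k) = 0"
  proof (rule ccontr)
    assume "(\<Sum>k\<in>UNIV. d k) \<noteq> 0"
    from dvd_imp_le_int[OF this dvd] small show False by simp
  qed
  have "d k = 0" for k
  proof -
    consider "\<forall>k. d k \<ge> 0" | "\<forall>k. d k \<le> 0"
      using spread by (smt (verit))
    then show ?thesis
    proof cases
      case 1
      then show ?thesis using sum0 sum_nonneg_eq_0_iff[of UNIV d] by auto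
    next
      case 2
      then show ?thesis using sum0 sum_nonneg_eq_0_iff[of UNIV "\<lambda>k. - d k"] by (auto simp: sum_negf)
    qed
  qed
  then show ?thesis by (simp add: d_def vec_eq_iff)
qed

lemma colored_fine_cover:
  fixes D :: "(real ^ 'n) set"
  assumes "compact D" "e > 0"
  obtains V :: "(int ^ 'n) set" and \<phi> where
    "finite V" "\<And>z. continuous_on UNIV (\<phi> z)"
    "\<And>t. t \<in> D \<Longrightarrow> \<exists>z\<in>V. \<phi> z t > (0::real)"
    "\<And>z t t'. \<phi> z t > 0 \<Longrightarrow> \<phi> z t' > 0 \<Longrightarrow> dist t t' < e"
    "\<And>z w t. \<phi> z t > 0 \<Longrightarrow> \<phi> w t > 0 \<Longrightarrow> lattice_color z = lattice_color w \<Longrightarrow> z = w"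
proof -
  \<comment> \<open>The \<open>+ 1\<close> makes the diameter bound of
    \<open>lattice_bump_dist\<close> strictly less than \<open>e\<close>.\<close>
  define h where "h = e / (2 * CARD('n) + 1)"
  have h: "h > 0" "2 * real CARD('n) * h < e" using assms by (auto simp: h_def field_simps)
  have "open {t. lattice_bump h z t > 0}" for z :: "int ^ 'n"
    by (intro open_Collect_less continuous_lattice_bump continuous_intros)
  moreover have "D \<subseteq> (\<Union>z\<in>UNIV. {t. lattice_bump h z t > 0})"
    using lattice_bump_floor_pos by blast
  ultimately obtain V :: "(int ^ 'n) set"
    where V: "finite V" "D \<subseteq> (\<Union>z\<in>V. {t. lattice_bump h z t > 0})"
    using compactE_image[OF assms(1), of UNIV "\<lambda>z. {t. lattice_bump h z t > 0}"] by metis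
  show ?thesis
  proof (rule that[of V "lattice_bump h"])
    show "dist t t' < e" if "lattice_bump h z t > 0" "lattice_bump h z t' > 0"
      for z :: "int ^ 'n" and t t'
      using lattice_bump_dist[OF h(1) that] h(2) by linarith
    show "\<exists>z\<in>V. lattice_bump h z t > 0" if "t \<in> D" for t
      using V that by blast
  qed (use V continuous_lattice_bump lattice_color_inj in auto)
qed

section \<open>Semicontinuity and compactness\<close>

text \<open>A non-maximiser loses strictly to some competitor, and each of the finitely many strict
  inequalities persists nearby.\<close>

lemma eventually_argmax_subset:
  fixes \<phi> :: "'i \<Rightarrow> 'a::topological_space \<Rightarrow> real"
  assumes "finite V" "\<And>z. continuous_on UNIV (\<phi> z)"
  shows "\<forall>\<^sub>F t' in at t within S. {z\<in>V. \<forall>w\<in>V. \<phi> w t' \<le> \<phi> z t'} \<subseteq> {z\<in>V. \<forall>w\<in>V. \<phi> w t \<le> \<phi> z t}"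
proof -
  have lim: "(\<phi> z \<longlongrightarrow> \<phi> z t) (at t within S)" for z
    using assms(2)[of z] continuous_on_subset[of UNIV "\<phi> z" "insert t S"]
    by (auto simp: continuous_on_def intro: tendsto_within_subset)
  have "\<forall>\<^sub>F t' in at t within S. \<phi> z t < \<phi> w t \<longrightarrow> \<phi> z t' < \<phi> w t'" for z w
  proof (cases "\<phi> z t < \<phi> w t")
    case True
    have "((\<lambda>t'. \<phi> w t' - \<phi> z t') \<longlongrightarrow> \<phi> w t - \<phi> z t) (at t within S)"
      by (intro tendsto_diff lim)
    from order_tendstoD(1)[OF this, of 0] True show ?thesis by (auto elim: eventually_mono)
  qed simp
  then have "\<forall>\<^sub>F t' in at t within S. \<forall>z\<in>V. \<forall>w\<in>V. \<phi> z t < \<phi> w t \<longrightarrow> \<phi> z t' < \<phi> w t'"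
    using assms(1) by (simp add: eventually_ball_finite)
  then show ?thesis by eventually_elim (auto simp: not_le[symmetric])
qed

lemma convex_compactum_differences:
  assumes "convex_compactum K" "convex_compactum C"
  shows "convex_compactum {k - c |k c. k \<in> K \<and> c \<in> C}"
proof -
  have "{k - c |k c. k \<in> K \<and> c \<in> C} = (\<Union>k\<in>K. \<Union>c\<in>C. {k - c})" by auto
  moreover have "compact {k - c |k c. k \<in> K \<and> c \<in> C}"
    using assms compact_differences[of K C] by (simp add: convex_compactum_def)
  ultimately show ?thesis
    using assms convex_differences[of K C] by (simp add: convex_compactum_def)
qed

text \<open>The open sets \<open>G x\<close> cover \<open>D\<close>, because a point outside
  \<open>U\<close> is expelled from \<open>K\<close> by some \<open>x\<close>; \<open>e\<close> is a
  Lebesgue number of this cover.\<close>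

lemma uniform_avoidance_radius:
  fixes K D U :: "'a::euclidean_space set"
  assumes "compact D" "closed K" "open U" "minkowski_diff K X \<subseteq> U" "X \<noteq> {}"
  obtains e where "e > 0"
    "\<And>t. t \<in> D \<Longrightarrow> \<exists>x\<in>X. \<forall>t'. dist t t' < e \<longrightarrow> t' + x \<notin> K \<or> t' \<in> U"
proof -
  define G where "G x = - {t. t + x \<in> K} \<union> U" for x
  have "closed {t. t + x \<in> K}" for x
    using continuous_closed_vimage[OF assms(2), of "\<lambda>t. t + x"] by (simp add: vimage_def)
  then have "open (G x)" for x using assms(3) by (auto simp: G_def)
  moreover have "D \<subseteq> \<Union> (G ` X)"
  proof
    fix t
    show "t \<in> \<Union> (G ` X)"
    proof (cases "t \<in> U")
      case True
      then show ?thesis using assms(5) by (auto simp: G_def)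
    next
      case False
      then have "t \<notin> minkowski_diff K X" using assms(4) by blast
      then show ?thesis by (auto simp: G_def mem_minkowski_diff)
    qed
  qed
  ultimately obtain e where e: "e > 0" "\<forall>t\<in>D. \<exists>B\<in>G ` X. ball t e \<subseteq> B"
    using Heine_Borel_lemma[OF assms(1), of "G ` X"] by (metis (no_types, lifting) imageE)
  have "\<exists>x\<in>X. \<forall>t'. dist t t' < e \<longrightarrow> t' + x \<notin> K \<or> t' \<in> U" if t: "t \<in> D" for t
  proof -
    obtain x where x: "x \<in> X" "ball t e \<subseteq> G x" using e t by blast
    have "t' + x \<notin> K \<or> t' \<in> U" if "dist t t' < e" for t'
      using x(2) that by (auto simp: G_def subset_eq)
    then show ?thesis using x(1) by blast
  qed
  then show ?thesis using e(1) that by blast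
qed

section \<open>The fixed-point argument\<close>

lemma rainbow_minkowski_diff_subset:
  fixes K C :: "(real ^ 'n) set"
    and X :: "nat \<Rightarrow> (real ^ 'n) set"
  defines "L \<equiv> {k - c |k c. k \<in> K \<and> c \<in> C}"
  assumes gen: "generating_set K"
    and C: "convex_compactum C"
    and fin: "\<And>i. i \<le> CARD('n) \<Longrightarrow> finite (X i)"
    and sub: "\<And>i. i \<le> CARD('n) \<Longrightarrow> minkowski_diff K (X i) \<subseteq> interior L"
  shows "\<exists>x. (\<forall>i\<le>CARD('n). x i \<in> X i) \<and> minkowski_diff K (x ` {..CARD('n)}) \<subseteq> L"
proof (rule ccontr)
  assume contr: "\<not> ?thesis"
  have rainbow: "\<not> minkowski_diff K (x ` {..CARD('n)}) \<subseteq> L"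
    if "\<And>i. i \<le> CARD('n) \<Longrightarrow> x i \<in> X i" for x
    using contr that by blast
  have K: "compact K" "convex K" using gen by (auto simp: generating_set_def convex_body_def)
  have L: "compact L" "convex L"
    using convex_compactum_differences[of K C] K C unfolding L_def by (auto simp: convex_compactum_def)
  \<comment> \<open>An empty \<open>X i\<close> would have the whole space as its difference, too
    large for the compact \<open>L\<close>.\<close>
  have ne: "X i \<noteq> {}" if i: "i \<le> CARD('n)" for i
  proof
    assume "X i = {}"
    then have "L = UNIV" using sub[OF i] interior_subset[of L] by (auto simp: minkowski_diff_def)
    then show False using L(1) not_compact_UNIV by blast
  qed
  \<comment> \<open>Default representatives, for colours absent from \<open>T t\<close> and vertices
    whose star misses \<open>D\<close>.\<close>
  define x0 where "x0 i = (SOME x. x \<in> X i)" for i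
  have x0: "x0 i \<in> X i" if "i \<le> CARD('n)" for i
    using ne[OF that] unfolding x0_def by (simp add: some_in_eq)
  have "finite (\<Union>i\<le>CARD('n). X i)" using fin by blast
  then have "bounded (\<Union>x\<in>(\<Union>i\<le>CARD('n). X i). translate_by K x)"
    using K(1) unfolding translate_by_def
    by (intro bounded_UN) (auto intro!: compact_imp_bounded compact_translation_subtract)
  then obtain R where R: "R > 0"
    "\<And>t. t \<in> (\<Union>x\<in>(\<Union>i\<le>CARD('n). X i). translate_by K x) \<Longrightarrow> norm t \<le> R"
    unfolding bounded_pos by blast
  \<comment> \<open>Large enough to contain every \<open>t\<close> with \<open>t + x \<in> K\<close>
    for some label \<open>x\<close>, so that \<open>g\<close> will map \<open>D\<close> into
    itself.\<close>
  define D :: "(real ^ 'n) set" where "D = cball 0 R"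
  have D: "compact D" "convex D" "D \<noteq> {}" using R by (auto simp: D_def)
  have inD: "t \<in> D" if "i \<le> CARD('n)" "x \<in> X i" "t + x \<in> K" for t x i
  proof -
    have "t \<in> translate_by K x" using that by (force simp: translate_by_def)
    then show ?thesis using R(2)[of t] that by (auto simp: D_def)
  qed
  have "\<exists>e>0. \<forall>t\<in>D. \<exists>x\<in>X i. \<forall>t'. dist t t' < e \<longrightarrow> t' + x \<notin> K \<or> t' \<in> interior L"
    if i: "i \<le> CARD('n)" for i
    using uniform_avoidance_radius[OF D(1) compact_imp_closed[OF K(1)] open_interior sub[OF i] ne[OF i]]
    by metis
  then obtain \<epsilon> where \<epsilon>: "\<And>i. i \<le> CARD('n) \<Longrightarrow> \<epsilon> i > 0"
    "\<And>i t. i \<le> CARD('n) \<Longrightarrow> t \<in> D \<Longrightarrow>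
       \<exists>x\<in>X i. \<forall>t'. dist t t' < \<epsilon> i \<longrightarrow> t' + x \<notin> K \<or> t' \<in> interior L"
    by metis
  define e where "e = Min (\<epsilon> ` {..CARD('n)})"
  have e: "e > 0" "\<And>i. i \<le> CARD('n) \<Longrightarrow> e \<le> \<epsilon> i" using \<epsilon>(1) by (auto simp: e_def)
  obtain V :: "(int ^ 'n) set" and \<phi> where V: "finite V"
    and cont: "\<And>z. continuous_on UNIV (\<phi> z)"
    and cover: "\<And>t. t \<in> D \<Longrightarrow> \<exists>z\<in>V. \<phi> z t > (0::real)"
    and small: "\<And>z t t'. \<phi> z t > 0 \<Longrightarrow> \<phi> z t' > 0 \<Longrightarrow> dist t t' < e"
    and inj: "\<And>z w t. \<phi> z t > 0 \<Longrightarrow> \<phi> w t > 0 \<Longrightarrow> lattice_color z = lattice_color w \<Longrightarrow> z = w"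
    using colored_fine_cover[OF D(1) e(1)] by metis
  \<comment> \<open>A label chosen at one point of the star works on the whole star, whose diameter
    is within the radius for its colour.\<close>
  have "\<exists>x\<in>X (lattice_color z). \<forall>t\<in>D. \<phi> z t > 0 \<longrightarrow> t + x \<notin> K \<or> t \<in> interior L" for z
  proof (cases "\<exists>t\<in>D. \<phi> z t > 0")
    case True
    then obtain t where t: "t \<in> D" "\<phi> z t > 0" by blast
    obtain x where x: "x \<in> X (lattice_color z)"
      "\<forall>t'. dist t t' < \<epsilon> (lattice_color z) \<longrightarrow> t' + x \<notin> K \<or> t' \<in> interior L"
      using \<epsilon>(2)[OF lattice_color_le t(1)] by blast
    have "t' + x \<notin> K \<or> t' \<in> interior L" if "\<phi> z t' > 0" for t'
      using x(2) small[OF t(2) that] e(2)[OF lattice_color_le, of z] by force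
    then show ?thesis using x(1) by blast
  next
    case False
    then show ?thesis using x0[OF lattice_color_le, of z] by blast
  qed
  then obtain \<xi> where \<xi>: "\<And>z. \<xi> z \<in> X (lattice_color z)"
    "\<And>z t. t \<in> D \<Longrightarrow> \<phi> z t > 0 \<Longrightarrow> t + \<xi> z \<notin> K \<or> t \<in> interior L"
    by metis
  \<comment> \<open>Maximality instead of mere positivity: near \<open>t\<close> the set of
    maximisers can only shrink, so \<open>A\<close> can only grow, as the selection lemma requires.
    The set of positive bumps behaves the opposite way.\<close>
  define T where "T t = {z\<in>V. \<forall>w\<in>V. \<phi> w t \<le> \<phi> z t}" for t
  define A where "A t = minkowski_diff K (\<xi> ` T t)" for t
  have T_pos: "\<phi> z t > 0" if "t \<in> D" "z \<in> T t" for z t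
    using cover[OF that(1)] that(2) by (force simp: T_def)
  have T_ne: "T t \<noteq> {}" if t: "t \<in> D" for t
  proof -
    have "V \<noteq> {}" using cover[OF t] by auto
    then have "Max ((\<lambda>z. \<phi> z t) ` V) \<in> (\<lambda>z. \<phi> z t) ` V" using V by simp
    then obtain z where z: "z \<in> V" "\<phi> z t = Max ((\<lambda>z. \<phi> z t) ` V)" by force
    then have "z \<in> T t" using V by (simp add: T_def)
    then show ?thesis by blast
  qed
  have A_convex: "convex (A t)" for t
    unfolding A_def by (rule convex_minkowski_diff[OF K(2)])
  have A_sub: "\<not> A t \<subseteq> L" if t: "t \<in> D" for t
  proof -
    \<comment> \<open>All vertices of \<open>T t\<close> have positive bumps at \<open>t\<close>, so
      each colour occurs at most once and \<open>SOME\<close> is determined. Thus \<open>y\<close>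
      is a rainbow choice extending the labels.\<close>
    define y where "y i = (if \<exists>z\<in>T t. lattice_color z = i
      then \<xi> (SOME z. z \<in> T t \<and> lattice_color z = i) else x0 i)" for i
    have y: "y (lattice_color z) = \<xi> z" if z: "z \<in> T t" for z
    proof -
      have "(SOME w. w \<in> T t \<and> lattice_color w = lattice_color z) = z"
        using z inj T_pos[OF t] by (intro some_equality) blast+
      then show ?thesis using z by (auto simp: y_def)
    qed
    have yX: "y i \<in> X i" if "i \<le> CARD('n)" for i
    proof (cases "\<exists>z\<in>T t. lattice_color z = i")
      case True
      then show ?thesis using y \<xi>(1) by metis
    qed (use x0 that in \<open>simp add: y_def\<close>)
    have "\<xi> ` T t \<subseteq> y ` {..CARD('n)}"
      using y lattice_color_le by (metis atMost_iff image_eqI image_subsetI)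
    then show ?thesis
      using rainbow[of y] yX minkowski_diff_antimono unfolding A_def by blast
  qed
  have A_ev: "\<forall>\<^sub>F t' in at t within D. A t \<subseteq> A t'" for t
    using eventually_argmax_subset[OF V, of \<phi>, OF cont, of t D]
    unfolding T_def[symmetric] A_def
    by eventually_elim (intro minkowski_diff_antimono image_mono)
  obtain p where p: "continuous_on D p" "\<And>t. t \<in> D \<Longrightarrow> p t \<in> separating_directions (A t) L"
  proof (rule continuous_selection_open_lower_sections[OF D(1), of "\<lambda>t. separating_directions (A t) L"])
    show "convex (separating_directions (A t) L)" if "t \<in> D" for t
      unfolding A_def L_def by (rule convex_separating_directions[OF gen]) (use T_ne[OF that] in simp)
    show "separating_directions (A t) L \<noteq> {}" if "t \<in> D" for t
      by (rule separating_directions_nonempty[OF compact_imp_closed[OF L(1)] L(2) A_sub[OF that]])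
    show "\<forall>\<^sub>F t' in at t within D. s \<in> separating_directions (A t') L"
      if "t \<in> D" "s \<in> separating_directions (A t) L" for t s
      using A_ev[of t] by eventually_elim (use that separating_directions_mono in blast)
  qed blast
  \<comment> \<open>The part of \<open>A t\<close> outside \<open>L\<close> need not be convex, so
    no point of it can be selected directly; its part beyond \<open>L\<close> in the fixed direction
    \<open>p t\<close> is convex.\<close>
  define H where "H t = {s. \<forall>l\<in>L. p t \<bullet> l < p t \<bullet> s}" for t
  obtain g where g: "continuous_on D g" "\<And>t. t \<in> D \<Longrightarrow> g t \<in> A t \<inter> H t"
  proof (rule continuous_selection_open_lower_sections[OF D(1), of "\<lambda>t. A t \<inter> H t"])
    have "H t = (\<Inter>l\<in>L. {s. p t \<bullet> s > p t \<bullet> l})" for t by (auto simp: H_def)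
    then have "convex (H t)" for t by (simp add: convex_INT convex_halfspace_gt)
    then show "convex (A t \<inter> H t)" for t using A_convex by (simp add: convex_Int)
    show "A t \<inter> H t \<noteq> {}" if "t \<in> D" for t
      using p(2)[OF that] by (auto simp: separating_directions_def H_def)
    show "\<forall>\<^sub>F t' in at t within D. s \<in> A t' \<inter> H t'" if "t \<in> D" "s \<in> A t \<inter> H t" for t s
    proof -
      have "\<forall>\<^sub>F t' in at t within D. s \<in> H t'"
        using eventually_separating[OF L(1) p(1) that(1), of s] that(2) by (simp add: H_def)
      with A_ev[of t] show ?thesis by eventually_elim (use that in blast)
    qed
  qed blast
  have gK: "g t + \<xi> z \<in> K" if "t \<in> D" "z \<in> T t" for t z
    using g(2)[OF that(1)] that(2) by (auto simp: A_def mem_minkowski_diff)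
  have "g ` D \<subseteq> D"
    using gK inD[OF lattice_color_le \<xi>(1)] T_ne by blast
  then obtain t where t: "t \<in> D" "g t = t"
    using brouwer[OF D(1,2,3) g(1)] by (metis image_subset_iff_funcset)
  obtain z where z: "z \<in> T t" using T_ne[OF t(1)] by blast
  have "t \<in> interior L" using \<xi>(2)[OF t(1) T_pos[OF t(1) z]] gK[OF t(1) z] t(2) by simp
  then have "t \<in> L" using interior_subset by blast
  then show False using g(2)[OF t(1)] t(2) by (auto simp: H_def)
qed

section \<open>Reduction by enlarging \<open>C\<close>\<close>

theorem theorem3p1:
  fixes K C :: "(real ^ 'n) set"
    and X :: "nat \<Rightarrow> (real ^ 'n) set"
  assumes "generating_set K"
    and "convex_compactum C"
    and "\<And>i. i \<le> CARD('n) \<Longrightarrow> finite (X i)"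
    and "\<And>x. (\<And>i. i \<le> CARD('n) \<Longrightarrow> x i \<in> X i) \<Longrightarrow>
           \<exists>t. separates (translate_by K t) (x ` {..CARD('n)}) C"
  shows "\<exists>i\<le>CARD('n). \<exists>t. separates (translate_by K t) (X i) C"
proof (rule ccontr)
  define L where "L = {k - c |k c. k \<in> K \<and> c \<in> C}"
  have sep: "(\<exists>t. separates (translate_by K t) S C) \<longleftrightarrow> \<not> minkowski_diff K S \<subseteq> L" for S
    by (auto simp: separates_translate_iff L_def)
  assume "\<not> ?thesis"
  then have sub: "minkowski_diff K (X i) \<subseteq> L" if "i \<le> CARD('n)" for i
    using sep that by blast
  have "convex_compactum K"
    using assms(1) by (auto simp: generating_set_def convex_body_def convex_compactum_def)
  then have L: "compact L"
    using convex_compactum_differences assms(2) unfolding L_def convex_compactum_def by blast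
  \<comment> \<open>A finite family that contains all rainbow sets; its finitely many witnesses
    \<open>\<tau> S\<close> stay at distance at least \<open>d\<close> from
    \<open>L\<close>.\<close>
  define F where "F = {S \<in> Pow (\<Union>i\<le>CARD('n). X i). \<not> minkowski_diff K S \<subseteq> L}"
  define \<tau> where "\<tau> S = (SOME t. t \<in> minkowski_diff K S - L)" for S
  have \<tau>: "\<tau> S \<in> minkowski_diff K S - L" if "S \<in> F" for S
    using that unfolding \<tau>_def F_def some_in_eq by blast
  have "finite F" using assms(3) by (simp add: F_def)
  then have "compact (\<tau> ` F)" by (simp add: finite_imp_compact)
  moreover have "\<tau> ` F \<inter> L = {}" using \<tau> by blast
  ultimately obtain d where d: "d > 0" "\<And>S l. S \<in> F \<Longrightarrow> l \<in> L \<Longrightarrow> d \<le> dist (\<tau> S) l"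
    using separate_compact_closed[OF _ compact_imp_closed[OF L], of "\<tau> ` F"] by blast
  \<comment> \<open>Enlarging \<open>C\<close> by a ball turns \<open>L\<close> into its closed
    d/2-neighbourhood \<open>L'\<close>: now \<open>L\<close> lies in the interior, and the
    witnesses remain outside.\<close>
  define C' where "C' = {c - u |c u. c \<in> C \<and> u \<in> cball 0 (d/2)}"
  define L' where "L' = {k - c |k c. k \<in> K \<and> c \<in> C'}"
  have C': "convex_compactum C'"
    unfolding C'_def by (rule convex_compactum_differences[OF assms(2)]) (simp add: convex_compactum_def)
  have L'_iff: "t \<in> L' \<longleftrightarrow> (\<exists>l\<in>L. dist l t \<le> d/2)" for t
  proof
    assume "t \<in> L'"
    then obtain k c u where *: "k \<in> K" "c \<in> C" "norm u \<le> d/2" "t = k - (c - u)"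
      by (auto simp: L'_def C'_def)
    then have "k - c \<in> L" by (auto simp: L_def)
    moreover have "dist (k - c) t \<le> d/2" using * by (simp add: dist_norm algebra_simps)
    ultimately show "\<exists>l\<in>L. dist l t \<le> d/2" by blast
  next
    assume "\<exists>l\<in>L. dist l t \<le> d/2"
    then obtain k c where *: "k \<in> K" "c \<in> C" "dist (k - c) t \<le> d/2" by (auto simp: L_def)
    define u where "u = t - (k - c)"
    have "u \<in> cball 0 (d/2)" using *(3) by (simp add: u_def dist_norm norm_minus_commute)
    then have "c - u \<in> C'" using *(2) unfolding C'_def by blast
    moreover have "t = k - (c - u)" by (simp add: u_def)
    ultimately show "t \<in> L'" using *(1) unfolding L'_def by blast
  qed
  have "L \<subseteq> interior L'"
  proof
    fix l assume "l \<in> L"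
    then have "ball l (d/2) \<subseteq> L'" by (force simp: L'_iff)
    then show "l \<in> interior L'" using d(1) by (auto simp: mem_interior intro!: exI[of _ "d/2"])
  qed
  then have "minkowski_diff K (X i) \<subseteq> interior L'" if "i \<le> CARD('n)" for i
    using sub[OF that] by blast
  from rainbow_minkowski_diff_subset[where X = X, OF assms(1) C' assms(3) this[unfolded L'_def]]
  obtain x where x: "\<forall>i\<le>CARD('n). x i \<in> X i" "minkowski_diff K (x ` {..CARD('n)}) \<subseteq> L'"
    unfolding L'_def by blast
  have S: "x ` {..CARD('n)} \<in> F"
    using x(1) assms(4)[of x] sep[of "x ` {..CARD('n)}"] by (auto simp: F_def)
  then have "\<tau> (x ` {..CARD('n)}) \<in> L'"
    using \<tau>[OF S] x(2) by blast
  then obtain l where "l \<in> L" "dist l (\<tau> (x ` {..CARD('n)})) \<le> d/2"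
    unfolding L'_iff by blast
  then show False using d(1) d(2)[OF S, of l] by (simp add: dist_commute)
qed

end
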